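(* Let $G$ be an abelian group and let $\varphi\in\mathrm{End}(G)$. The following conditions are equivalent: (i) $s_0(\varphi)>0$; (ii) $s_0(\varphi)=\infty$; (iii) $\mathrm{sc}(\varphi)\cap\ker_\infty\varphi\neq 0$.
   Context: $\mathbb N=\{0,1,2,\dots\}$ and $\mathbb N_+=\mathbb N\setminus\{0\}$. Let $\varphi$ be an endomorphism of an abelian group $G$. A string of $\varphi$ is a sequence $S=\{x_n\}_{n\in\mathbb N}$ of pairwise distinct elements of $G$ with $\varphi(x_n)=x_{n-1}$ for every $n\in\mathbb N_+$. A null string is a string with $x_0\neq 0$ and $\varphi^k(x_0)=0$ for some $k\in\mathbb N_+$. The null string number is $s_0(\varphi)=\sup\{|\mathcal F|:\mathcal F$ is a family of pairwise disjoint null strings of $\varphi$ in $G\}$ (disjointness refers to the underlying sets of elements); it takes values in $\mathbb N\cup\{\infty\}$, i.e. it is set equal to $\infty$ whenever the supremum is infinite. The surjective core $\mathrm{sc}(\varphi)$ is the largest subset $\Lambda\subseteq G$ with $\varphi(\Lambda)=\Lambda$ (it always exists and is a subgroup of $G$). The hyperkernel is $\ker_\infty\varphi=\bigcup_{n\in\mathbb N}\ker(\varphi^n)$. *)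

theory Defs
  imports Main "HOL-Library.Extended_Nat"
begin

definition is_string :: "('a::ab_group_add \<Rightarrow> 'a) \<Rightarrow> (nat \<Rightarrow> 'a) \<Rightarrow> bool" where
  "is_string \<phi> x \<longleftrightarrow> inj x \<and> (\<forall>n>0. \<phi> (x n) = x (n - 1))"

definition null_string :: "('a::ab_group_add \<Rightarrow> 'a) \<Rightarrow> (nat \<Rightarrow> 'a) \<Rightarrow> bool" where
  "null_string \<phi> x \<longleftrightarrow> is_string \<phi> x \<and> x 0 \<noteq> 0 \<and> (\<exists>k>0. (\<phi> ^^ k) (x 0) = 0)"

(* All infinite cardinalities are identified with \<infinity>. *)
definition ecard :: "'a set \<Rightarrow> enat" where
  "ecard A = (if finite A then enat (card A) else \<infinity>)"

(* A family may be taken to be a set of strings: the underlying sets are nonempty,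
   so a family of pairwise disjoint strings has no repetitions. *)
definition null_string_number :: "('a::ab_group_add \<Rightarrow> 'a) \<Rightarrow> enat" where
  "null_string_number \<phi> =
    (SUP F \<in> {F. (\<forall>x\<in>F. null_string \<phi> x) \<and> pairwise (\<lambda>x y. disjnt (range x) (range y)) F}.
       ecard F)"

definition surjective_core :: "('a::ab_group_add \<Rightarrow> 'a) \<Rightarrow> 'a set" where
  "surjective_core \<phi> = (GREATEST \<Lambda>. \<phi> ` \<Lambda> = \<Lambda>)"

definition hyperkernel :: "('a::ab_group_add \<Rightarrow> 'a) \<Rightarrow> 'a set" where
  "hyperkernel \<phi> = (\<Union>n. {x. (\<phi> ^^ n) x = 0})"

(* The greatest set in the definition of surjective_core exists. *)
lemma surjective_core_eq_Union: "surjective_core \<phi> = \<Union>{\<Lambda>. \<phi> ` \<Lambda> = \<Lambda>}"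
  unfolding surjective_core_def
proof (rule Greatest_equality)
  show "\<phi> ` \<Union>{\<Lambda>. \<phi> ` \<Lambda> = \<Lambda>} = \<Union>{\<Lambda>. \<phi> ` \<Lambda> = \<Lambda>}"
    by (simp add: image_Union)
next
  fix \<Lambda> assume "\<phi> ` \<Lambda> = \<Lambda>"
  then show "\<Lambda> \<subseteq> \<Union>{\<Lambda>. \<phi> ` \<Lambda> = \<Lambda>}"
    by blast
qed

lemma image_surjective_core: "\<phi> ` surjective_core \<phi> = surjective_core \<phi>"
  by (simp add: surjective_core_eq_Union image_Union)

lemma surjective_core_greatest: "\<phi> ` \<Lambda> = \<Lambda> \<Longrightarrow> \<Lambda> \<subseteq> surjective_core \<phi>"
  by (auto simp: surjective_core_eq_Union)

end

theory Submission
  imports Defs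
begin

text \<open>
  A null string together with the forward orbit of its first term is mapped onto itself by
  \<open>\<phi>\<close>, so that first term is a nonzero element of the surjective core and of the hyperkernel.

  Conversely, take a nonzero element of the intersection. Its last nonzero iterate \<open>x 0\<close> lies in
  the core and in the kernel of \<open>\<phi>\<close>, and repeatedly choosing preimages inside the core gives
  \<open>x\<close> with \<open>\<phi> (x (Suc n)) = x n\<close>. Say that an element has level \<open>n\<close> if it is carried to \<open>x 0\<close>
  by exactly \<open>n\<close> steps; then \<open>x n\<close> has level \<open>n\<close>, and elements of different levels are different.
  The point is that this one sequence gives infinitely many disjoint null strings
  \<open>\<lambda>n. x (n + m) + x n\<close>, one for each \<open>m > 0\<close>. The term \<open>x n\<close> does not affect the level,
  which is \<open>n + m\<close>, so a coincidence between two of these strings forces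
  \<open>n + m = n' + m'\<close>; cancelling the equal summands leaves \<open>x n = x n'\<close>, hence \<open>n = n'\<close> and
  \<open>m = m'\<close> (\<open>shifted_sum_eq_iff\<close>). Thus one null string already gives infinitely many.
\<close>

lemma additive_funpow:
  fixes \<phi> :: "'a::ab_group_add \<Rightarrow> 'a"
  assumes "additive \<phi>"
  shows "additive (\<phi> ^^ n)"
proof (induction n)
  case 0
  show ?case by (simp add: additive_def)
next
  case (Suc n)
  then show ?case using assms by (simp add: additive_def)
qed

lemma funpow_image_eq_mem:
  assumes "\<phi> ` A = A" "x \<in> A"
  shows "(\<phi> ^^ n) x \<in> A"
  using assms by (induction n) auto

text \<open>
  The forward orbit has to be adjoined because the terms of a string alone need not be closed
  under \<open>\<phi>\<close>: nothing is required of \<open>\<phi> (x 0)\<close>. Preimages inside the set are never lacking,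
  since every iterate is reached from its predecessor and \<open>x n\<close> from \<open>x (Suc n)\<close>.
\<close>

lemma string_start_in_surjective_core:
  assumes "is_string \<phi> x"
  shows "x 0 \<in> surjective_core \<phi>"
proof -
  let ?S = "range x \<union> range (\<lambda>k. (\<phi> ^^ k) (x 0))"
  have step: "\<phi> (x (Suc n)) = x n" for n
    using assms by (simp add: is_string_def)
  have "\<phi> (x n) \<in> ?S" for n
  proof (cases n)
    case 0
    have "(\<phi> ^^ 1) (x 0) \<in> ?S" by blast
    then show ?thesis using 0 by simp
  qed (simp add: step)
  moreover have "\<phi> ((\<phi> ^^ k) (x 0)) \<in> ?S" for k
  proof -
    have "(\<phi> ^^ Suc k) (x 0) \<in> ?S" by blast
    then show ?thesis by simp
  qed
  moreover have x_img: "x n \<in> \<phi> ` ?S" for n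
    by (rule image_eqI[of _ _ "x (Suc n)"]) (simp_all add: step)
  moreover have "(\<phi> ^^ k) (x 0) \<in> \<phi> ` ?S" for k
  proof (cases k)
    case 0
    then show ?thesis using x_img[of 0] by simp
  next
    case (Suc j)
    then show ?thesis by (intro image_eqI[of _ _ "(\<phi> ^^ j) (x 0)"]) auto
  qed
  ultimately have "\<phi> ` ?S = ?S" by blast
  from surjective_core_greatest[OF this] show ?thesis by blast
qed

lemma null_string_start:
  assumes "null_string \<phi> x"
  shows "x 0 \<in> surjective_core \<phi> \<inter> hyperkernel \<phi> - {0}"
  using assms string_start_in_surjective_core
  by (auto simp: null_string_def hyperkernel_def)

lemma zero_in_surjective_core_hyperkernel:
  assumes "additive \<phi>"
  shows "0 \<in> surjective_core \<phi> \<inter> hyperkernel \<phi>"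
proof -
  have "\<phi> ` {0} = {0}" using additive.zero[OF assms] by simp
  moreover have "(\<phi> ^^ 0) 0 = 0" by simp
  ultimately show ?thesis
    using surjective_core_greatest[of \<phi> "{0}"] unfolding hyperkernel_def by blast
qed

locale kernel_chain =
  fixes \<phi> :: "'a::ab_group_add \<Rightarrow> 'a" and x :: "nat \<Rightarrow> 'a"
  assumes additive: "additive \<phi>"
    and start_nonzero: "x 0 \<noteq> 0"
    and start_kernel: "\<phi> (x 0) = 0"
    and step: "\<phi> (x (Suc n)) = x n"
begin

lemma funpow_chain: "(\<phi> ^^ n) (x (n + k)) = x k"
  by (induction n) (simp_all add: step funpow_swap1)

lemma funpow_zero: "(\<phi> ^^ n) 0 = 0"
  by (rule additive.zero[OF additive_funpow[OF additive]])

lemma funpow_chain_zero: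
  assumes "n < k"
  shows "(\<phi> ^^ k) (x n) = 0"
proof -
  have "k = (k - Suc n) + Suc n" using assms by simp
  then have "(\<phi> ^^ k) (x n) = (\<phi> ^^ (k - Suc n)) ((\<phi> ^^ Suc n) (x n))"
    by (metis funpow_add comp_apply)
  then show ?thesis
    using funpow_chain[of n 0] by (simp add: start_kernel funpow_zero)
qed

lemma inj_chain: "inj x"
proof (rule linorder_injI)
  fix i j :: nat
  assume "i < j"
  then have "(\<phi> ^^ j) (x i) \<noteq> (\<phi> ^^ j) (x j)"
    using funpow_chain[of j 0] funpow_chain_zero start_nonzero by simp
  then show "x i \<noteq> x j" by metis
qed

lemma funpow_shifted_sum:
  assumes "m > 0"
  shows "(\<phi> ^^ (n + m)) (x (n + m) + x n) = x 0"
  using funpow_chain[of "n + m" 0] funpow_chain_zero[of n "n + m"] assms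
  by (simp add: additive.add[OF additive_funpow[OF additive]])

lemma funpow_shifted_sum_zero:
  assumes "n + m < k"
  shows "(\<phi> ^^ k) (x (n + m) + x n) = 0"
  using assms by (simp add: additive.add[OF additive_funpow[OF additive]] funpow_chain_zero)

text \<open>
  This carries both the injectivity of each string and the disjointness of any two of them.
  The condition \<open>m > 0\<close> is what keeps \<open>x (n + m)\<close> the summand of strictly larger level:
  for \<open>m = 0\<close> the sum is \<open>x n + x n\<close>, which vanishes in a group of exponent two.
\<close>

lemma shifted_sum_eq_iff:
  assumes "m > 0" "m' > 0"
  shows "x (n + m) + x n = x (n' + m') + x n' \<longleftrightarrow> n = n' \<and> m = m'"
proof
  assume eq: "x (n + m) + x n = x (n' + m') + x n'"
  have "n + m = n' + m'"
  proof (rule linorder_cases[of "n + m" "n' + m'"])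
    assume "n + m < n' + m'"
    from funpow_shifted_sum_zero[OF this] funpow_shifted_sum[OF assms(2)] eq start_nonzero
    show ?thesis by metis
  next
    assume "n' + m' < n + m"
    from funpow_shifted_sum_zero[OF this] funpow_shifted_sum[OF assms(1)] eq start_nonzero
    show ?thesis by metis
  qed
  moreover from this eq have "x n = x n'" by simp
  then have "n = n'" using inj_chain by (simp add: inj_eq)
  ultimately show "n = n' \<and> m = m'" by simp
qed simp

lemma null_string_shifted_sum:
  assumes "m > 0"
  shows "null_string \<phi> (\<lambda>n. x (n + m) + x n)"
proof -
  have "inj (\<lambda>n. x (n + m) + x n)"
    using shifted_sum_eq_iff[OF assms assms] by (simp add: inj_def)
  moreover have "\<phi> (x (n + m) + x n) = x (n - 1 + m) + x (n - 1)" if "n > 0" for n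
    using that by (cases n) (simp_all add: additive.add[OF additive] step)
  moreover have "x (0 + m) + x 0 \<noteq> 0"
    using funpow_shifted_sum[OF assms, of 0] funpow_zero start_nonzero by metis
  moreover have "(\<phi> ^^ Suc m) (x (0 + m) + x 0) = 0"
    by (rule funpow_shifted_sum_zero) simp
  ultimately show ?thesis
    unfolding null_string_def is_string_def by blast
qed

lemma null_string_number_infinite: "null_string_number \<phi> = \<infinity>"
proof -
  let ?y = "\<lambda>m n. x (n + m) + x n"
  let ?F = "?y ` {0<..}"
  have disj: "disjnt (range (?y m)) (range (?y m'))"
    if "m > 0" "m' > 0" "m \<noteq> m'" for m m'
    using that shifted_sum_eq_iff[OF that(1,2)] by (auto simp: disjnt_def)
  have "inj_on ?y {0<..}"
  proof (rule inj_onI)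
    fix m m' :: nat
    assume "m \<in> {0<..}" "m' \<in> {0<..}" "?y m = ?y m'"
    then show "m = m'"
      using shifted_sum_eq_iff[of m m' 0 0] fun_cong[of "?y m" "?y m'" 0] by simp
  qed
  then have "infinite ?F"
    using infinite_Ioi[of "0::nat"] by (simp add: finite_image_iff)
  then have "ecard ?F = \<infinity>" by (simp add: ecard_def)
  moreover have "pairwise (\<lambda>x y. disjnt (range x) (range y)) ?F"
    using disj by (auto simp: pairwise_def)
  moreover have "\<forall>y\<in>?F. null_string \<phi> y"
    using null_string_shifted_sum by auto
  ultimately have "\<infinity> \<le> null_string_number \<phi>"
    unfolding null_string_number_def by (intro SUP_upper2[of ?F]) auto
  then show ?thesis by simp
qed

end

lemma kernel_chain_exists:
  assumes "additive \<phi>" "z \<in> surjective_core \<phi> \<inter> hyperkernel \<phi>" "z \<noteq> 0"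
  obtains x where "kernel_chain \<phi> x"
proof -
  let ?C = "surjective_core \<phi>"
  from assms obtain k where "(\<phi> ^^ k) z = 0" by (auto simp: hyperkernel_def)
  then obtain j where j: "(\<phi> ^^ j) z \<noteq> 0" "(\<phi> ^^ Suc j) z = 0"
    using ex_least_nat_less[of "\<lambda>k. (\<phi> ^^ k) z = 0" k] assms(3) by fastforce
  define f where "f a = (SOME b. b \<in> ?C \<and> \<phi> b = a)" for a
  have f: "f a \<in> ?C \<and> \<phi> (f a) = a" if "a \<in> ?C" for a
  proof -
    have "\<exists>b. b \<in> ?C \<and> \<phi> b = a"
      using that image_surjective_core[of \<phi>] by (metis imageE)
    then show ?thesis unfolding f_def by (rule someI_ex)
  qed
  define x where "x n = (f ^^ n) ((\<phi> ^^ j) z)" for n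
  have "x n \<in> ?C" for n
  proof (induction n)
    case 0
    show ?case
      using assms(2) funpow_image_eq_mem[OF image_surjective_core, of z \<phi> j]
      by (simp add: x_def)
  next
    case (Suc n)
    then show ?case using f by (simp add: x_def)
  qed
  then have "\<phi> (x (Suc n)) = x n" for n
    using f[of "x n"] by (simp add: x_def)
  with assms(1) j have "kernel_chain \<phi> x"
    by unfold_locales (simp_all add: x_def additive_def)
  then show thesis by (rule that)
qed

lemma null_string_if_number_pos:
  assumes "null_string_number \<phi> > 0"
  obtains x where "null_string \<phi> x"
proof -
  from assms obtain F where F: "\<forall>x\<in>F. null_string \<phi> x" "ecard F > 0"
    unfolding null_string_number_def by (auto simp: less_SUP_iff)
  then have "F \<noteq> {}" by (auto simp: ecard_def zero_enat_def)
  with F show thesis using that by blast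
qed

theorem mainTheorem3:
  fixes \<phi> :: "'a::ab_group_add \<Rightarrow> 'a"
  assumes "additive \<phi>"
  shows "(null_string_number \<phi> > 0 \<longleftrightarrow> null_string_number \<phi> = \<infinity>)
    \<and> (null_string_number \<phi> = \<infinity> \<longleftrightarrow> surjective_core \<phi> \<inter> hyperkernel \<phi> \<noteq> {0})"
proof -
  have "surjective_core \<phi> \<inter> hyperkernel \<phi> \<noteq> {0}" if "null_string_number \<phi> > 0"
    using null_string_if_number_pos[OF that] null_string_start by (metis DiffE)
  moreover have "null_string_number \<phi> = \<infinity>"
    if "surjective_core \<phi> \<inter> hyperkernel \<phi> \<noteq> {0}"
  proof -
    have "surjective_core \<phi> \<inter> hyperkernel \<phi> - {0} \<noteq> {}"
      using that zero_in_surjective_core_hyperkernel[OF assms]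
      by (metis Diff_eq_empty_iff subset_singletonD empty_iff)
    then obtain z where "z \<in> surjective_core \<phi> \<inter> hyperkernel \<phi>" "z \<noteq> 0"
      by (metis DiffD1 DiffD2 all_not_in_conv singletonI)
    then obtain x where "kernel_chain \<phi> x" by (rule kernel_chain_exists[OF assms])
    then show ?thesis by (rule kernel_chain.null_string_number_infinite)
  qed
  moreover have "null_string_number \<phi> > 0" if "null_string_number \<phi> = \<infinity>"
    using that by simp
  ultimately show ?thesis by metis
qed

end
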